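(* Let $d \geq 1$ be an integer and let $n, m \geq 1$ be integers. There exist functions $c, c' : (0,\infty) \to (0,\infty)$ (depending only on $d, n, m$) such that for every $\rho > 0$ and all finite sets $A, B \subset \mathbb{Z}^d$ with $|A| = n$, $|B| = m$ and $A \cap B = \emptyset$, $$ \big| U_\rho(A,B) \big| \leq c'(\rho)\, e^{-c(\rho)\, d(A,B)} . $$ Moreover, $c$ can be chosen so that there exist $\tilde{c} > 0$ and $\rho_0 > 0$, depending only on $d, n, m$, with $c(\rho) = \tilde{c}\,\rho$ for all $0 < \rho \leq \rho_0$.
   Context: Consider the graph with vertex set $\mathbb{Z}^d$ and edges $\{x,y\}$ for all $x,y \in \mathbb{Z}^d$ that are nearest neighbours (i.e. at Euclidean distance $1$); $d(x,y)$ denotes the graph distance (the $\ell^1$ distance) on $\mathbb{Z}^d$, and for non-empty $A,B \subset \mathbb{Z}^d$, $d(A,B) := \min_{u \in A, v \in B} d(u,v)$. (The letter $d$ also denotes the dimension.) For a finite set $K \subset \mathbb{Z}^d$, let $E_K$ be the set of nearest-neighbour edges with both endpoints in $K$. A monomer-dimer configuration in $K$ is a pair $\omega = (M, D)$ where $M \subset K$ (the set of monomers) and $D \subset E_K$ (the set of dimers) is a perfect matching of the graph induced on $K \setminus M$; that is, no edge of $D$ touches $M$ and every vertex of $K \setminus M$ belongs to exactly one edge of $D$. Let $\Omega_K$ be the (finite) set of all such configurations. For $\rho \geq 0$ the partition function is $$\mathbb{Z}_{K,\rho} := \sum_{(M,D) \in \Omega_K} \rho^{|M|},$$ with $\mathbb{Z}_{\emptyset,\rho}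 = 1$. For $\rho>0$ and disjoint $A, B \subset K$ define $$U_{K,\rho}(A,B) := \frac{\mathbb{Z}_{K \setminus (A \cup B),\rho}}{\mathbb{Z}_{K,\rho}} - \frac{\mathbb{Z}_{K \setminus A,\rho}}{\mathbb{Z}_{K,\rho}} \cdot \frac{\mathbb{Z}_{K \setminus B,\rho}}{\mathbb{Z}_{K,\rho}},$$ and, for finite disjoint $A, B \subset \mathbb{Z}^d$, $$U_\rho(A,B) := \lim_{K \uparrow \mathbb{Z}^d} U_{K,\rho}(A,B),$$ where the limit is taken in the sense of van Hove (along increasing sequences of finite sets $K$ exhausting $\mathbb{Z}^d$ whose boundary-to-volume ratio tends to $0$). It is a known fact (Gruber and Kunz) that this limit exists for every $\rho > 0$. *)

theory Defs
  imports "HOL-Analysis.Analysis"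
begin

text \<open>The lattice \<open>\<int>\<^sup>d\<close> is the type \<open>int ^ 'd\<close> with \<open>d = CARD('d)\<close>.\<close>

definition euclid_dist :: "int ^ 'd \<Rightarrow> int ^ 'd \<Rightarrow> real" where
  "euclid_dist x y = L2_set (\<lambda>i. real_of_int (x $ i - y $ i)) UNIV"

definition nn_edges :: "(int ^ 'd) set \<Rightarrow> (int ^ 'd) set set" where
  "nn_edges K = {{x, y} | x y. x \<in> K \<and> y \<in> K \<and> euclid_dist x y = 1}"

definition lattice_dist :: "int ^ 'd \<Rightarrow> int ^ 'd \<Rightarrow> nat" where
  "lattice_dist x y = (\<Sum>i\<in>UNIV. nat \<bar>x $ i - y $ i\<bar>)"

text \<open>For non-empty \<open>A\<close> and \<open>B\<close> the infimum of this set of natural numbers is its minimum.\<close>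

definition lattice_setdist :: "(int ^ 'd) set \<Rightarrow> (int ^ 'd) set \<Rightarrow> nat" where
  "lattice_setdist A B = Inf {lattice_dist u v | u v. u \<in> A \<and> v \<in> B}"

definition monomer_dimer_configs ::
    "(int ^ 'd) set \<Rightarrow> ((int ^ 'd) set \<times> (int ^ 'd) set set) set" where
  "monomer_dimer_configs K =
    {(M, D). M \<subseteq> K \<and> D \<subseteq> nn_edges K \<and> (\<forall>e\<in>D. e \<inter> M = {}) \<and>
             (\<forall>v\<in>K - M. \<exists>!e. e \<in> D \<and> v \<in> e)}"

definition partition_fun :: "(int ^ 'd) set \<Rightarrow> real \<Rightarrow> real" where
  "partition_fun K \<rho> = (\<Sum>(M, D)\<in>monomer_dimer_configs K. \<rho> ^ card M)"

definition U_finite ::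
    "(int ^ 'd) set \<Rightarrow> real \<Rightarrow> (int ^ 'd) set \<Rightarrow> (int ^ 'd) set \<Rightarrow> real" where
  "U_finite K \<rho> A B =
     partition_fun (K - (A \<union> B)) \<rho> / partition_fun K \<rho>
     - (partition_fun (K - A) \<rho> / partition_fun K \<rho>) * (partition_fun (K - B) \<rho> / partition_fun K \<rho>)"

definition vertex_boundary :: "(int ^ 'd) set \<Rightarrow> (int ^ 'd) set" where
  "vertex_boundary K = {x \<in> K. \<exists>y. y \<notin> K \<and> euclid_dist x y = 1}"

definition van_hove :: "(nat \<Rightarrow> (int ^ 'd) set) \<Rightarrow> bool" where
  "van_hove K \<longleftrightarrow>
     incseq K \<and> (\<forall>k. finite (K k)) \<and> (\<Union>k. K k) = UNIV \<and>
     (\<lambda>k. real (card (vertex_boundary (K k))) / real (card (K k))) \<longlonglongrightarrow> 0"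

text \<open>
  The common limit along all van Hove sequences. For finite \<open>A\<close> and \<open>B\<close>, the inclusion
  \<open>A \<union> B \<subseteq> K k\<close> holds for all large \<open>k\<close>, so that the values of \<^const>\<open>U_finite\<close> for
  smaller sets are irrelevant.
\<close>

definition U_inf :: "real \<Rightarrow> (int ^ 'd) set \<Rightarrow> (int ^ 'd) set \<Rightarrow> real" where
  "U_inf \<rho> A B = (THE u. \<forall>K. van_hove K \<longrightarrow> (\<lambda>k. U_finite (K k) \<rho> A B) \<longlonglongrightarrow> u)"

end

theory Submission
  imports Defs "HOL-Real_Asymp.Real_Asymp"
begin

text \<open>
  Deleting one vertex gives \<open>Z(K) = \<rho> * Z(K - v) + (\<Sum>w. Z(K - v - w))\<close>, where \<open>w\<close> runs over the
  neighbours of \<open>v\<close> in \<open>K\<close>. Hence \<open>R(K,v) = Z(K - v) / Z(K)\<close> satisfies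
  \<open>1 / R(K,v) = \<rho> + (\<Sum>w. R(K - v,w))\<close>. In the variable \<open>u = 2 / R - \<rho>\<close> this reads
  \<open>u(K,v) = \<rho> + (\<Sum>w. 4 / (u(K - v,w) + \<rho>))\<close>, and one step of this recursion contracts \<open>ln u\<close> by the
  factor \<open>1 - min (1/2) (\<rho> / 2d)\<close>, since there are at most \<open>2d\<close> neighbours. Iterating, \<open>R(K,v)\<close> and
  \<open>R(K',v)\<close> are exponentially close when \<open>K\<close> and \<open>K'\<close> agree on a large ball around \<open>v\<close>. The quotients
  \<open>V(K,A) = Z(K - A) / Z(K)\<close> are products of \<open>card A\<close> such ratios, and the covariance of \<open>A\<close> and \<open>B\<close> is
  \<open>V(K,B) * (V(K - B,A) - V(K,A))\<close>, where \<open>K - B\<close> and \<open>K\<close> agree near \<open>A\<close>. The same estimate shows that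
  the infinite-volume limit exists.
\<close>

section \<open>Lattice geometry\<close>

definition nbrs :: "int ^ 'd \<Rightarrow> (int ^ 'd) set" where
  "nbrs v = {w. euclid_dist v w = 1}"

text \<open>Squaring removes the root and the reals, so facts about neighbours reduce to integer
  arithmetic.\<close>

lemma nbrs_iff: "w \<in> nbrs v \<longleftrightarrow> (\<Sum>i\<in>UNIV. (v $ i - w $ i)\<^sup>2) = 1"
proof -
  have "w \<in> nbrs v \<longleftrightarrow> (\<Sum>i\<in>UNIV. (real_of_int (v $ i - w $ i))\<^sup>2) = 1"
    by (simp add: nbrs_def euclid_dist_def L2_set_def)
  also have "(\<Sum>i\<in>UNIV. (real_of_int (v $ i - w $ i))\<^sup>2) = real_of_int (\<Sum>i\<in>UNIV. (v $ i - w $ i)\<^sup>2)"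
    by simp
  finally show ?thesis by linarith
qed

lemma not_in_nbrs_self [simp]: "v \<notin> nbrs v"
  by (simp add: nbrs_iff)

lemma nbrs_sym: "w \<in> nbrs v \<longleftrightarrow> v \<in> nbrs w"
  by (simp add: nbrs_iff power2_commute)

text \<open>A sum of integer squares is 1 only if one term is 1 and the others vanish.\<close>

lemma nbrs_axis:
  fixes v w :: "int ^ 'd"
  assumes "w \<in> nbrs v"
  shows "\<exists>i. w = v + axis i 1 \<or> w = v - axis i 1"
proof -
  have s: "(\<Sum>i\<in>UNIV. (v $ i - w $ i)\<^sup>2) = 1"
    using assms by (simp add: nbrs_iff)
  then obtain i where i: "v $ i - w $ i \<noteq> 0"
    by (metis (mono_tags, lifting) sum.neutral zero_neq_one zero_power2)
  have split: "(v $ i - w $ i)\<^sup>2 + (\<Sum>j\<in>UNIV - {i}. (v $ j - w $ j)\<^sup>2) = 1"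
    using s by (simp add: sum.remove[of UNIV i])
  have "(v $ i - w $ i)\<^sup>2 \<ge> 1"
    using i by (simp add: int_one_le_iff_zero_less)
  moreover have rest: "(\<Sum>j\<in>UNIV - {i}. (v $ j - w $ j)\<^sup>2) \<ge> 0"
    by (simp add: sum_nonneg)
  ultimately have one: "(v $ i - w $ i)\<^sup>2 = 1" and "(\<Sum>j\<in>UNIV - {i}. (v $ j - w $ j)\<^sup>2) = 0"
    using split by linarith+
  then have "v $ j = w $ j" if "j \<noteq> i" for j
    using that by (subst (asm) sum_nonneg_eq_0_iff) auto
  moreover have "w $ i = v $ i + 1 \<or> w $ i = v $ i - 1"
    using one by (auto simp: power2_eq_1_iff)
  ultimately show ?thesis
    by (intro exI[of _ i]) (auto simp: vec_eq_iff axis_def)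
qed

lemma nbrs_subset_axes:
  "nbrs v \<subseteq> (\<lambda>i. v + axis i 1) ` UNIV \<union> (\<lambda>i. v - axis i 1) ` UNIV"
  using nbrs_axis by blast

lemma finite_nbrs [simp]: "finite (nbrs v)"
  by (rule finite_subset[OF nbrs_subset_axes]) simp

lemma card_nbrs_le: "card (nbrs (v :: int ^ 'd)) \<le> 2 * CARD('d)"
proof -
  have "card (nbrs v) \<le> card ((\<lambda>i. v + axis i 1) ` UNIV \<union> (\<lambda>i. v - axis i 1) ` UNIV)"
    by (rule card_mono[OF _ nbrs_subset_axes]) simp
  also have "\<dots> \<le> card ((\<lambda>i. v + axis i 1) ` UNIV) + card ((\<lambda>i. v - axis i 1) ` UNIV)"
    by (rule card_Un_le)
  also have "\<dots> \<le> CARD('d) + CARD('d)"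
    by (intro add_mono card_image_le) simp_all
  finally show ?thesis by simp
qed

lemma lattice_dist_triangle: "lattice_dist x z \<le> lattice_dist x y + lattice_dist y z"
  unfolding lattice_dist_def sum.distrib[symmetric] by (intro sum_mono) linarith

lemma lattice_dist_nbrs:
  assumes "w \<in> nbrs v"
  shows "lattice_dist v w = 1"
proof -
  obtain i where i: "w = v + axis i 1 \<or> w = v - axis i 1"
    using nbrs_axis[OF assms] by blast
  have "lattice_dist v w = (\<Sum>j\<in>UNIV. if j = i then 1 else 0)"
    unfolding lattice_dist_def using i by (intro sum.cong) (auto simp: axis_def)
  then show ?thesis by simp
qed

lemma lattice_dist_self [simp]: "lattice_dist v v = 0"
  by (simp add: lattice_dist_def)

lemma lattice_dist_eq_0_iff: "lattice_dist v w = 0 \<longleftrightarrow> v = w"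
  by (auto simp: lattice_dist_def vec_eq_iff)

section \<open>Vertex deletion for the partition function\<close>

lemma nn_edges_eq: "nn_edges K = {{x, y} | x y. x \<in> K \<and> y \<in> K \<and> y \<in> nbrs x}"
  by (simp add: nn_edges_def nbrs_def)

lemma edge_at_vertex:
  assumes "e \<in> nn_edges K" "v \<in> e"
  obtains w where "e = {v, w}" "w \<in> K" "w \<in> nbrs v"
proof -
  obtain x y where e: "e = {x, y}" "x \<in> K" "y \<in> K" "y \<in> nbrs x"
    using assms(1) unfolding nn_edges_eq by blast
  show thesis
  proof (cases "v = x")
    case True
    then show thesis using e that[of y] by simp
  next
    case False
    then have "v = y" using assms(2) e by simp
    then show thesis using e that[of x] nbrs_sym[of y x] by (simp add: insert_commute)
  qed
qed

section \<open>Configurations with a prescribed monomer or dimer\<close>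

lemma in_configs_iff:
  "(M, D) \<in> monomer_dimer_configs K \<longleftrightarrow> M \<subseteq> K \<and> D \<subseteq> nn_edges K \<and>
     (\<forall>e\<in>D. e \<inter> M = {}) \<and> (\<forall>x\<in>K - M. \<exists>!e. e \<in> D \<and> x \<in> e)"
  by (simp add: monomer_dimer_configs_def)

lemma configsI:
  assumes "M \<subseteq> K" "D \<subseteq> nn_edges K" "\<And>e. e \<in> D \<Longrightarrow> e \<inter> M = {}"
    and "\<And>x. x \<in> K \<Longrightarrow> x \<notin> M \<Longrightarrow> \<exists>!e. e \<in> D \<and> x \<in> e"
  shows "(M, D) \<in> monomer_dimer_configs K"
  using assms by (simp add: in_configs_iff)

lemma configsD:
  assumes "(M, D) \<in> monomer_dimer_configs K"
  shows "M \<subseteq> K" "D \<subseteq> nn_edges K" "\<And>e. e \<in> D \<Longrightarrow> e \<inter> M = {}"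
    and "\<And>x. x \<in> K \<Longrightarrow> x \<notin> M \<Longrightarrow> \<exists>!e. e \<in> D \<and> x \<in> e"
  using assms by (simp_all add: in_configs_iff)

lemma nn_edges_mono: "K \<subseteq> L \<Longrightarrow> nn_edges K \<subseteq> nn_edges L"
  unfolding nn_edges_def by blast

lemma nn_edges_subset: "e \<in> nn_edges K \<Longrightarrow> e \<subseteq> K"
  unfolding nn_edges_def by blast

lemma nn_edges_restrict: "e \<in> nn_edges K \<Longrightarrow> e \<subseteq> L \<Longrightarrow> e \<in> nn_edges L"
  unfolding nn_edges_def by blast

lemma finite_configs:
  assumes "finite K"
  shows "finite (monomer_dimer_configs K)"
proof -
  have "nn_edges K \<subseteq> Pow K"
    using nn_edges_subset by blast
  then have "monomer_dimer_configs K \<subseteq> Pow K \<times> Pow (Pow K)"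
    by (auto simp: monomer_dimer_configs_def)
  then show ?thesis
    by (rule finite_subset) (simp add: assms)
qed

text \<open>No dimer touches the monomer \<open>v\<close>, so the dimers already form a
  configuration of \<open>K - {v}\<close>.\<close>

lemma configs_monomer:
  assumes "v \<in> K"
  shows "{(M, D) \<in> monomer_dimer_configs K. v \<in> M} =
    (\<lambda>(M, D). (insert v M, D)) ` monomer_dimer_configs (K - {v})" (is "?L = ?R")
proof (intro equalityI subsetI)
  fix p assume "p \<in> ?L"
  then obtain M D where p: "p = (M, D)" and c: "(M, D) \<in> monomer_dimer_configs K" and v: "v \<in> M"
    by blast
  have D: "D \<subseteq> nn_edges (K - {v})"
  proof
    fix e assume "e \<in> D"
    with c v have "e \<in> nn_edges K" "v \<notin> e"
      by (auto simp: in_configs_iff)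
    then show "e \<in> nn_edges (K - {v})"
      using nn_edges_subset[of e K] by (auto intro: nn_edges_restrict[of e K])
  qed
  have "(M - {v}, D) \<in> monomer_dimer_configs (K - {v})"
  proof (rule configsI[OF _ D])
    show "M - {v} \<subseteq> K - {v}" using configsD(1)[OF c] by blast
    show "e \<inter> (M - {v}) = {}" if "e \<in> D" for e using configsD(3)[OF c that] by blast
    show "\<exists>!e. e \<in> D \<and> x \<in> e" if "x \<in> K - {v}" "x \<notin> M - {v}" for x
      using that by (intro configsD(4)[OF c]) auto
  qed
  moreover have "p = (\<lambda>(M, D). (insert v M, D)) (M - {v}, D)"
    using p v by auto
  ultimately show "p \<in> ?R" by blast
next
  fix p assume "p \<in> ?R"
  then obtain M D where p: "p = (insert v M, D)" and c: "(M, D) \<in> monomer_dimer_configs (K - {v})"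
    by auto
  have "(insert v M, D) \<in> monomer_dimer_configs K"
  proof (rule configsI)
    show "insert v M \<subseteq> K" using configsD(1)[OF c] assms by blast
    show "D \<subseteq> nn_edges K"
      using configsD(2)[OF c] nn_edges_mono[of "K - {v}" K] by blast
    show "e \<inter> insert v M = {}" if "e \<in> D" for e
      using configsD(3)[OF c that] configsD(2)[OF c] nn_edges_subset[of e "K - {v}"] that by blast
    show "\<exists>!e. e \<in> D \<and> x \<in> e" if "x \<in> K" "x \<notin> insert v M" for x
      using that by (intro configsD(4)[OF c]) auto
  qed
  then show "p \<in> ?L" using p by blast
qed

text \<open>The dimer \<open>{v, w}\<close> is the only one at \<open>v\<close> and at
  \<open>w\<close>. All others avoid both ends, so it splits off without affecting the rest of the
  matching.\<close>

lemma configs_dimer: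
  assumes "v \<in> K" "w \<in> K" "w \<in> nbrs v"
  shows "{(M, D) \<in> monomer_dimer_configs K. {v, w} \<in> D} =
    (\<lambda>(M, D). (M, insert {v, w} D)) ` monomer_dimer_configs (K - {v, w})" (is "?L = ?R")
proof (intro equalityI subsetI)
  fix p assume "p \<in> ?L"
  then obtain M D where p: "p = (M, D)" and c: "(M, D) \<in> monomer_dimer_configs K"
      and vw: "{v, w} \<in> D"
    by blast
  have M: "v \<notin> M" "w \<notin> M"
    using configsD(3)[OF c vw] by auto
  have uniq: "e = {v, w}" if "e \<in> D" "v \<in> e \<or> w \<in> e" for e
    using that vw configsD(4)[OF c assms(1) M(1)] configsD(4)[OF c assms(2) M(2)] by auto
  have D: "D - {{v, w}} \<subseteq> nn_edges (K - {v, w})"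
  proof
    fix e assume e: "e \<in> D - {{v, w}}"
    with c have "e \<in> nn_edges K"
      by (auto simp: in_configs_iff)
    moreover have "v \<notin> e" "w \<notin> e" using uniq e by auto
    ultimately show "e \<in> nn_edges (K - {v, w})"
      using nn_edges_subset[of e K] by (auto intro: nn_edges_restrict[of e K])
  qed
  have "\<exists>!e. e \<in> D - {{v, w}} \<and> x \<in> e" if x: "x \<in> K - {v, w} - M" for x
  proof -
    have "\<exists>!e. e \<in> D \<and> x \<in> e" using x by (intro configsD(4)[OF c]) auto
    moreover have "x \<notin> {v, w}" using x by blast
    ultimately show ?thesis by (metis DiffE DiffI singletonD)
  qed
  then have "(M, D - {{v, w}}) \<in> monomer_dimer_configs (K - {v, w})"
    using configsD(1,3)[OF c] M by (intro configsI[OF _ D]) auto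
  moreover have "p = (\<lambda>(M, D). (M, insert {v, w} D)) (M, D - {{v, w}})"
    using p vw by auto
  ultimately show "p \<in> ?R" by blast
next
  fix p assume "p \<in> ?R"
  then obtain M D where p: "p = (M, insert {v, w} D)"
      and c: "(M, D) \<in> monomer_dimer_configs (K - {v, w})"
    by auto
  have nin: "v \<notin> e \<and> w \<notin> e" if "e \<in> D" for e
    using configsD(2)[OF c] that nn_edges_subset[of e "K - {v, w}"] by blast
  have D: "insert {v, w} D \<subseteq> nn_edges K"
  proof -
    have "{v, w} \<in> nn_edges K" using assms by (auto simp: nn_edges_eq)
    then show ?thesis
      using configsD(2)[OF c] nn_edges_mono[of "K - {v, w}" K] by blast
  qed
  have "\<exists>!e. e \<in> insert {v, w} D \<and> x \<in> e" if x: "x \<in> K - M" for x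
  proof (cases "x \<in> {v, w}")
    case True
    then show ?thesis using nin by blast
  next
    case False
    then have "\<exists>!e. e \<in> D \<and> x \<in> e" using x by (intro configsD(4)[OF c]) auto
    then show ?thesis using False by (metis insert_iff)
  qed
  moreover have "e \<inter> M = {}" if "e \<in> insert {v, w} D" for e
    using that configsD(1)[OF c] configsD(3)[OF c, of e] by auto
  ultimately have "(M, insert {v, w} D) \<in> monomer_dimer_configs K"
    using configsD(1)[OF c] by (intro configsI[OF _ D]) auto
  then show "p \<in> ?L" using p by blast
qed

lemma configs_decompose:
  assumes "v \<in> K"
  shows "monomer_dimer_configs K = {(M, D) \<in> monomer_dimer_configs K. v \<in> M} \<union>
    (\<Union>w\<in>K \<inter> nbrs v. {(M, D) \<in> monomer_dimer_configs K. {v, w} \<in> D})"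
proof -
  have "\<exists>w\<in>K \<inter> nbrs v. {v, w} \<in> D"
    if c: "(M, D) \<in> monomer_dimer_configs K" and v: "v \<notin> M" for M D
  proof -
    obtain e where e: "e \<in> D" "v \<in> e"
      using configsD(4)[OF c assms v] by blast
    then have "e \<in> nn_edges K" using configsD(2)[OF c] by blast
    then obtain w where "e = {v, w}" "w \<in> K" "w \<in> nbrs v"
      using e(2) by (rule edge_at_vertex)
    then show ?thesis using e by blast
  qed
  then show ?thesis by blast
qed

text \<open>Configurations are sorted by what happens at \<open>v\<close>: it is a monomer, of
  weight \<open>\<rho>\<close>, or its unique dimer leads to some neighbour \<open>w\<close> in
  \<open>K\<close>. These cases exclude one another.\<close>

lemma partition_fun_rec:
  assumes "finite K" "v \<in> K"
  shows "partition_fun K \<rho> =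
    \<rho> * partition_fun (K - {v}) \<rho> + (\<Sum>w\<in>K \<inter> nbrs v. partition_fun (K - {v, w}) \<rho>)"
proof -
  let ?C = monomer_dimer_configs
  let ?f = "\<lambda>(M :: (int ^ 'a) set, D :: (int ^ 'a) set set). \<rho> ^ card M"
  let ?A = "{(M, D) \<in> ?C K. v \<in> M}"
  let ?B = "\<lambda>w. {(M, D) \<in> ?C K. {v, w} \<in> D}"
  have fin: "finite ?A" "\<And>w. finite (?B w)"
    by (rule finite_subset[OF _ finite_configs[OF assms(1)]]; blast)+
  have disj: "?A \<inter> (\<Union>w\<in>K \<inter> nbrs v. ?B w) = {}"
    by (auto simp: in_configs_iff)
  have disjB: "?B w \<inter> ?B w' = {}" if "w \<noteq> w'" for w w'
  proof -
    have False if c: "(M, D) \<in> ?C K" and D: "{v, w} \<in> D" "{v, w'} \<in> D" for M D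
    proof -
      have "v \<notin> M" using configsD(3)[OF c D(1)] by blast
      then have "{v, w} = {v, w'}" using D configsD(4)[OF c assms(2)] by blast
      then show False using \<open>w \<noteq> w'\<close> by (auto simp: doubleton_eq_iff)
    qed
    then show ?thesis by blast
  qed
  have sumA: "sum ?f ?A = \<rho> * partition_fun (K - {v}) \<rho>"
  proof -
    \<comment> \<open>Absence of \<open>v\<close> from \<open>M\<close> makes reinsertion injective;
      together with finiteness it raises \<open>card M\<close> by exactly one, which is the factor
      \<open>\<rho>\<close>.\<close>
    have M: "v \<notin> M \<and> finite M" if "(M, D) \<in> ?C (K - {v})" for M D
      using that assms by (auto simp: in_configs_iff dest: finite_subset)
    have inj: "inj_on (\<lambda>(M, D). (insert v M, D)) (?C (K - {v}))"
      using M by (fastforce simp: inj_on_def insert_ident)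
    show ?thesis
      unfolding configs_monomer[OF assms(2)] sum.reindex[OF inj] partition_fun_def sum_distrib_left
      using M by (intro sum.cong) auto
  qed
  have sumB: "sum ?f (?B w) = partition_fun (K - {v, w}) \<rho>" if w: "w \<in> K \<inter> nbrs v" for w
  proof -
    have D: "{v, w} \<notin> D" if "(M, D) \<in> ?C (K - {v, w})" for M D
      using configsD(2)[OF that] nn_edges_subset[of "{v, w}" "K - {v, w}"] by blast
    have inj: "inj_on (\<lambda>(M, D). (M, insert {v, w} D)) (?C (K - {v, w}))"
      using D by (fastforce simp: inj_on_def insert_ident)
    show ?thesis
      using w configs_dimer[of v K w] assms(2)
      by (auto simp: sum.reindex[OF inj] partition_fun_def intro!: sum.cong)
  qed
  have "partition_fun K \<rho> = sum ?f (?A \<union> (\<Union>w\<in>K \<inter> nbrs v. ?B w))"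
    unfolding partition_fun_def using configs_decompose[OF assms(2)] by simp
  also have "\<dots> = sum ?f ?A + sum ?f (\<Union>w\<in>K \<inter> nbrs v. ?B w)"
    using fin disj assms by (intro sum.union_disjoint) auto
  also have "sum ?f (\<Union>w\<in>K \<inter> nbrs v. ?B w) = (\<Sum>w\<in>K \<inter> nbrs v. sum ?f (?B w))"
    using fin disjB assms by (intro sum.UNION_disjoint) auto
  finally show ?thesis
    using sumA sumB by simp
qed

text \<open>The configuration consisting of monomers only has positive weight, and no weight is
  negative.\<close>

lemma partition_fun_pos:
  assumes "finite K" "\<rho> > 0"
  shows "partition_fun K \<rho> > 0"
proof -
  have "(K, {}) \<in> monomer_dimer_configs K"
    by (simp add: in_configs_iff)
  then show ?thesis
    unfolding partition_fun_def using assms finite_configs[OF assms(1)]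
    by (intro sum_pos2[of _ "(K, {})"]) (auto split: prod.splits)
qed

section \<open>Boxes and van Hove sequences\<close>

lemma bij_betw_vec_nth_box:
  "bij_betw vec_nth {x :: 'a ^ 'd. \<forall>i. x $ i \<in> S} (UNIV \<rightarrow>\<^sub>E S)"
  by (rule bij_betw_byWitness[where f' = vec_lambda]) auto

lemma card_vec_box: "card {x :: 'a ^ 'd. \<forall>i. x $ i \<in> S} = card S ^ CARD('d)"
  using bij_betw_same_card[OF bij_betw_vec_nth_box] by (simp add: card_PiE)

lemma finite_vec_box:
  assumes "finite S"
  shows "finite {x :: 'a ^ 'd. \<forall>i. x $ i \<in> S}"
  using bij_betw_finite[OF bij_betw_vec_nth_box, of S] assms by (simp add: finite_PiE)

lemma finite_lattice_ball: "finite {x :: int ^ 'd. lattice_dist v x \<le> l}"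
proof -
  \<comment> \<open>The union over \<open>j\<close> provides one range that serves all coordinates,
    as \<open>finite_vec_box\<close> requires.\<close>
  have "x $ i \<in> (\<Union>j. {v $ j - int l..v $ j + int l})" if "lattice_dist v x \<le> l" for x :: "int ^ 'd" and i
  proof -
    have "nat \<bar>v $ i - x $ i\<bar> \<le> lattice_dist v x"
      unfolding lattice_dist_def by (intro member_le_sum) auto
    then have "x $ i \<in> {v $ i - int l..v $ i + int l}" using that by auto
    then show ?thesis by blast
  qed
  then have "{x. lattice_dist v x \<le> l} \<subseteq> {x. \<forall>i. x $ i \<in> (\<Union>j. {v $ j - int l..v $ j + int l})}"
    by blast
  then show ?thesis
    by (rule finite_subset) (intro finite_vec_box, simp)
qed

definition box_seq :: "nat \<Rightarrow> (int ^ 'd) set" where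
  "box_seq k = {x. \<forall>i. x $ i \<in> {- int k..int k}}"

lemma card_box_seq: "card (box_seq k :: (int ^ 'd) set) = (2 * k + 1) ^ CARD('d)"
  unfolding box_seq_def card_vec_box by (simp add: nat_add_distrib nat_mult_distrib)

lemma finite_box_seq: "finite (box_seq k)"
  unfolding box_seq_def by (rule finite_vec_box) simp

lemma box_seq_mono: "k \<le> l \<Longrightarrow> box_seq k \<subseteq> box_seq l"
  unfolding box_seq_def by (auto intro: order_trans[of "- int l" "- int k"] order_trans[of _ "int k" "int l"])

text \<open>A step to a neighbour changes each coordinate by at most 1, so no step leads from
  \<open>box_seq k\<close> out of \<open>box_seq (Suc k)\<close>.\<close>

lemma vertex_boundary_box_seq:
  "vertex_boundary (box_seq (Suc k)) \<subseteq> box_seq (Suc k) - box_seq k"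
proof
  fix x :: "int ^ 'd" assume "x \<in> vertex_boundary (box_seq (Suc k))"
  then obtain y where x: "x \<in> box_seq (Suc k)" and y: "y \<notin> box_seq (Suc k)" "y \<in> nbrs x"
    by (auto simp: vertex_boundary_def nbrs_def)
  then obtain i where i: "y $ i \<notin> {- int (Suc k)..int (Suc k)}"
    by (auto simp: box_seq_def)
  have "nat \<bar>x $ i - y $ i\<bar> \<le> lattice_dist x y"
    unfolding lattice_dist_def by (intro member_le_sum) auto
  then have "\<bar>x $ i - y $ i\<bar> \<le> 1" using lattice_dist_nbrs[OF y(2)] by simp
  with i have "x $ i \<notin> {- int k..int k}" by auto
  then have "x \<notin> box_seq k" unfolding box_seq_def by blast
  with x show "x \<in> box_seq (Suc k) - box_seq k" by blast
qed

text \<open>The definite description in \<open>U_inf\<close> has a unique solution only if some van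
  Hove sequence exists; cubes provide one.\<close>

lemma van_hove_box_seq: "van_hove (box_seq :: nat \<Rightarrow> (int ^ 'd) set)"
proof -
  have "\<exists>k. x \<in> box_seq k" for x :: "int ^ 'd"
  proof
    have "nat \<bar>x $ i\<bar> \<le> (\<Sum>j\<in>UNIV. nat \<bar>x $ j\<bar>)" for i
      by (intro member_le_sum) auto
    then have "\<bar>x $ i\<bar> \<le> int (\<Sum>j\<in>UNIV. nat \<bar>x $ j\<bar>)" for i
      by (meson nat_le_iff)
    then show "x \<in> box_seq (\<Sum>j\<in>UNIV. nat \<bar>x $ j\<bar>)"
      unfolding box_seq_def by (auto simp: abs_le_iff minus_le_iff)
  qed
  then have cover: "(\<Union>k. box_seq k) = (UNIV :: (int ^ 'd) set)" by blast
  let ?r = "\<lambda>k. real (card (vertex_boundary (box_seq k :: (int ^ 'd) set))) / real (card (box_seq k :: (int ^ 'd) set))"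
  \<comment> \<open>The shift to \<open>Suc k\<close> leaves a smaller cube inside; the boundary
    lies in the shell between the two, whose share of the volume tends to 0.\<close>
  have bound: "?r (Suc k) \<le> 1 - (real (2 * k + 1) / real (2 * k + 3)) ^ CARD('d)" for k
  proof -
    have "card (vertex_boundary (box_seq (Suc k) :: (int ^ 'd) set))
        \<le> card (box_seq (Suc k) - box_seq k :: (int ^ 'd) set)"
      by (intro card_mono finite_Diff finite_box_seq vertex_boundary_box_seq)
    also have "\<dots> = (2 * k + 3) ^ CARD('d) - (2 * k + 1) ^ CARD('d)"
      using card_Diff_subset[OF finite_box_seq, of k "box_seq (Suc k) :: (int ^ 'd) set"]
        box_seq_mono[of k "Suc k"]
      by (simp add: card_box_seq numeral_3_eq_3)
    finally have "real (card (vertex_boundary (box_seq (Suc k) :: (int ^ 'd) set)))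
        \<le> real ((2 * k + 3) ^ CARD('d) - (2 * k + 1) ^ CARD('d))"
      by (rule of_nat_mono)
    also have "\<dots> = real (2 * k + 3) ^ CARD('d) - real (2 * k + 1) ^ CARD('d)"
      by (subst of_nat_diff) (auto intro!: power_mono)
    finally have "?r (Suc k) \<le> (real (2 * k + 3) ^ CARD('d) - real (2 * k + 1) ^ CARD('d)) / real (2 * k + 3) ^ CARD('d)"
      by (simp add: card_box_seq divide_right_mono numeral_3_eq_3)
    also have "\<dots> = 1 - (real (2 * k + 1) / real (2 * k + 3)) ^ CARD('d)"
      by (simp add: diff_divide_distrib power_divide)
    finally show ?thesis .
  qed
  have "(\<lambda>k. real (2 * k + 1) / real (2 * k + 3)) \<longlonglongrightarrow> 1"
    by real_asymp
  then have "(\<lambda>k. 1 - (real (2 * k + 1) / real (2 * k + 3)) ^ CARD('d)) \<longlonglongrightarrow> 1 - 1 ^ CARD('d)"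
    by (intro tendsto_intros)
  then have "(\<lambda>k. 1 - (real (2 * k + 1) / real (2 * k + 3)) ^ CARD('d)) \<longlonglongrightarrow> 0"
    by simp
  then have "(\<lambda>k. ?r (Suc k)) \<longlonglongrightarrow> 0"
    by (rule real_tendsto_sandwich[OF _ _ tendsto_const, rotated 2])
       (use bound in \<open>auto intro!: always_eventually\<close>)
  then have "?r \<longlonglongrightarrow> 0" by (rule LIMSEQ_imp_Suc)
  then show ?thesis
    unfolding van_hove_def incseq_def using finite_box_seq cover box_seq_mono by blast
qed

text \<open>An increasing exhaustion eventually contains any given finite set. A limit over the
  directed family of all finite sets therefore passes to every van Hove sequence.\<close>

lemma van_hove_imp_filterlim:
  assumes "van_hove K"
  shows "filterlim K (finite_subsets_at_top UNIV) sequentially"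
  unfolding filterlim_finite_subsets_at_top
proof (intro allI impI)
  fix X :: "(int ^ 'a) set" assume X: "finite X \<and> X \<subseteq> UNIV"
  have "\<forall>\<^sub>F k in sequentially. x \<in> K k" for x
  proof -
    obtain k where "x \<in> K k" using assms unfolding van_hove_def by blast
    then have "x \<in> K j" if "j \<ge> k" for j
      using assms that unfolding van_hove_def incseq_def by blast
    then show ?thesis unfolding eventually_sequentially by blast
  qed
  then have "\<forall>\<^sub>F k in sequentially. \<forall>x\<in>X. x \<in> K k"
    using X by (intro eventually_ball_finite) auto
  then show "\<forall>\<^sub>F k in sequentially. finite (K k) \<and> X \<subseteq> K k \<and> K k \<subseteq> UNIV"
    by eventually_elim (use assms in \<open>auto simp: van_hove_def\<close>)
qed

section \<open>Contraction of the vertex recursion\<close>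

text \<open>With \<open>x i = 2 / (u i + \<rho>)\<close>, the left side is the derivative of the
  recursion in logarithmic coordinates, up to sign, and the bracket on the right is its value. In
  terms of the sums \<open>S\<close> and \<open>Q\<close> below, the claim reduces to
  \<open>e * \<rho> + 2 * e * S \<le> \<rho> + \<rho> * Q\<close>. The bound
  \<open>e \<le> 1 / 2\<close> uses up half of the first \<open>\<rho>\<close>;
  \<open>e \<le> \<rho> / N\<close> with Cauchy-Schwarz fits the rest into the other half and
  \<open>\<rho> * Q\<close>.\<close>

lemma recursion_derivative_bound:
  fixes x :: "'i \<Rightarrow> real"
  assumes "card I \<le> N" "N \<ge> 2" "\<rho> > 0" "e \<le> 1 / 2" "e \<le> \<rho> / real N"
    and "\<And>i. i \<in> I \<Longrightarrow> x i \<ge> 0"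
  shows "(\<Sum>i\<in>I. 2 * x i - \<rho> * (x i)\<^sup>2) \<le> (1 - e) * (\<rho> + 2 * (\<Sum>i\<in>I. x i))"
proof -
  define S where "S = (\<Sum>i\<in>I. x i)"
  define Q where "Q = (\<Sum>i\<in>I. (x i)\<^sup>2)"
  have S: "S \<ge> 0" and Q: "Q \<ge> 0"
    unfolding S_def Q_def using assms by (auto intro: sum_nonneg)
  have "S\<^sup>2 \<le> Q * real (card I)"
    unfolding S_def Q_def by (rule sum_squared_le_sum_of_squares)
  also have "\<dots> \<le> Q * real N"
    using Q assms(1) by (intro mult_left_mono) auto
  finally have SQ: "S\<^sup>2 / real N \<le> Q"
    using assms(2) by (simp add: pos_divide_le_eq)
  have "2 * S \<le> real N / 2 + S\<^sup>2"  \<comment> \<open>AM-GM, and \<open>N \<ge> 2\<close>\<close>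
    using sum_squares_bound[of S 1] assms(2) by simp
  then have "(2 * S) / real N \<le> (real N / 2 + S\<^sup>2) / real N"
    by (intro divide_right_mono) simp_all
  also have "\<dots> = 1 / 2 + S\<^sup>2 / real N"
    using assms(2) by (simp add: add_divide_distrib)
  finally have "2 * S / real N \<le> 1 / 2 + Q" using SQ by linarith
  then have "\<rho> * (2 * S / real N) \<le> \<rho> * (1 / 2 + Q)"
    using assms(3) by (intro mult_left_mono) auto
  moreover have "e * (2 * S) \<le> \<rho> / real N * (2 * S)"
    using S assms(5) by (intro mult_right_mono) auto
  moreover have "e * \<rho> \<le> 1 / 2 * \<rho>"
    using assms(3,4) by (intro mult_right_mono) auto
  ultimately have "e * \<rho> + e * (2 * S) \<le> \<rho> + \<rho> * Q"
    by (simp add: algebra_simps)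
  moreover have "(\<Sum>i\<in>I. 2 * x i - \<rho> * (x i)\<^sup>2) = 2 * S - \<rho> * Q"
    by (simp add: S_def Q_def sum_subtractf sum_distrib_left)
  ultimately show ?thesis
    unfolding S_def[symmetric] by (simp add: algebra_simps)
qed

text \<open>The recursion reverses order: a bound on \<open>u'\<close> in terms of \<open>u\<close>
  becomes a bound on the image of \<open>u\<close> in terms of the image of
  \<open>u'\<close>.\<close>

lemma recursion_contraction:
  fixes u u' :: "'i \<Rightarrow> real"
  assumes N: "card I \<le> N" "N \<ge> 2" and \<rho>: "\<rho> > 0" and e: "e \<le> 1 / 2" "e \<le> \<rho> / real N"
    and u: "\<And>i. i \<in> I \<Longrightarrow> u i > 0" and u': "\<And>i. i \<in> I \<Longrightarrow> u' i > 0"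
    and \<delta>: "\<delta> \<ge> 0" and le: "\<And>i. i \<in> I \<Longrightarrow> u' i \<le> exp \<delta> * u i"
  shows "\<rho> + (\<Sum>i\<in>I. 4 / (u i + \<rho>)) \<le> exp ((1 - e) * \<delta>) * (\<rho> + (\<Sum>i\<in>I. 4 / (u' i + \<rho>)))"
proof -
  \<comment> \<open>\<open>F\<close> follows the image while \<open>u'\<close> is scaled down by
    \<open>exp (- t)\<close>. At 0 it is the image of \<open>u'\<close>; at \<open>\<delta>\<close>
    the scaled \<open>u'\<close> lies below \<open>u\<close>, so \<open>F \<delta>\<close> dominates
    the image of \<open>u\<close>.\<close>
  define F where "F t = \<rho> + (\<Sum>i\<in>I. 4 / (u' i * exp (- t) + \<rho>))" for t
  define F' where "F' t = (\<Sum>i\<in>I. 4 * (u' i * exp (- t)) / (u' i * exp (- t) + \<rho>)\<^sup>2)" for t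
  have pos: "u' i * exp (- t) + \<rho> > 0" if "i \<in> I" for i t
    using u'[OF that] \<rho> by (intro add_pos_pos mult_pos_pos) auto
  have der: "(F has_real_derivative F' t) (at t)" for t
    unfolding F_def F'_def
    by (rule derivative_eq_intros refl | (use pos[of _ t] in force))+
       (auto intro!: sum.cong simp: power2_eq_square)
  have F'_le: "F' t \<le> (1 - e) * F t" for t
  proof -
    define x where "x i = 2 / (u' i * exp (- t) + \<rho>)" for i
    have "F' t = (\<Sum>i\<in>I. 2 * x i - \<rho> * (x i)\<^sup>2)"
      unfolding F'_def
    proof (intro sum.cong refl)
      fix i assume "i \<in> I"
      then have p: "u' i * exp (- t) + \<rho> \<noteq> 0" using pos[of i t] by simp
      have "2 * (2 / s) - \<rho> * (2 / s)\<^sup>2 = 4 * (s - \<rho>) / s\<^sup>2" if "s \<noteq> 0" for s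
        using that by (simp add: field_simps power2_eq_square)
      from this[OF p] show "4 * (u' i * exp (- t)) / (u' i * exp (- t) + \<rho>)\<^sup>2 = 2 * x i - \<rho> * (x i)\<^sup>2"
        unfolding x_def by simp
    qed
    also have "\<dots> \<le> (1 - e) * (\<rho> + 2 * (\<Sum>i\<in>I. x i))"
      using pos[of _ t] by (intro recursion_derivative_bound[OF N \<rho> e]) (auto simp: x_def less_imp_le)
    also have "\<rho> + 2 * (\<Sum>i\<in>I. x i) = F t"
      by (simp add: F_def x_def sum_distrib_left)
    finally show ?thesis .
  qed
  \<comment> \<open>Gronwall's argument: \<open>F' t \<le> (1 - e) * F t\<close> makes
    \<open>F t * exp (- ((1 - e) * t))\<close> nonincreasing.\<close>
  have "F \<delta> * exp (- ((1 - e) * \<delta>)) \<le> F 0 * exp (- ((1 - e) * 0))"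
  proof (rule DERIV_nonpos_imp_nonincreasing[OF \<delta>])
    fix t
    have "((\<lambda>t. F t * exp (- ((1 - e) * t))) has_real_derivative
        (F' t - (1 - e) * F t) * exp (- ((1 - e) * t))) (at t)"
      by (rule derivative_eq_intros der refl)+ (simp add: algebra_simps)
    moreover have "(F' t - (1 - e) * F t) * exp (- ((1 - e) * t)) \<le> 0"
      using F'_le[of t] by (intro mult_nonpos_nonneg) auto
    ultimately show "\<exists>y. ((\<lambda>t. F t * exp (- ((1 - e) * t))) has_real_derivative y) (at t) \<and> y \<le> 0"
      by blast
  qed
  then have F: "F \<delta> \<le> exp ((1 - e) * \<delta>) * F 0"
    by (simp add: exp_minus pos_divide_le_eq mult.commute flip: divide_inverse)
  have "4 / (u i + \<rho>) \<le> 4 / (u' i * exp (- \<delta>) + \<rho>)" if "i \<in> I" for i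
  proof -
    have "u' i * exp (- \<delta>) \<le> u i"
      using le[OF that] by (simp add: exp_minus field_simps)
    then show ?thesis using pos[OF that, of \<delta>] by (intro divide_left_mono) (auto intro!: mult_pos_pos u[OF that] add_pos_pos \<rho>)
  qed
  then have "\<rho> + (\<Sum>i\<in>I. 4 / (u i + \<rho>)) \<le> F \<delta>"
    unfolding F_def by (intro add_left_mono sum_mono)
  with F show ?thesis by (simp add: F_def)
qed

section \<open>Decay of correlations in finite volume\<close>

text \<open>
  The one-step contraction fails to be of order \<open>\<rho>\<close> for \<open>ln R\<close> itself; it holds for
  \<open>ln (2 / R - \<rho>)\<close>.
\<close>

definition msg :: "real \<Rightarrow> (int ^ 'd) set \<Rightarrow> int ^ 'd \<Rightarrow> real" where
  "msg \<rho> K v = 2 * partition_fun K \<rho> / partition_fun (K - {v}) \<rho> - \<rho>"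

text \<open>For \<open>A \<subseteq> K\<close>, multiplying by \<open>\<rho> ^ card A\<close> gives
  the probability that all vertices of \<open>A\<close> are monomers.\<close>

definition vacancy :: "real \<Rightarrow> (int ^ 'd) set \<Rightarrow> (int ^ 'd) set \<Rightarrow> real" where
  "vacancy \<rho> K A = partition_fun (K - A) \<rho> / partition_fun K \<rho>"

lemma vacancy_singleton:
  assumes "finite K" "\<rho> > 0"
  shows "vacancy \<rho> K {v} = 2 / (msg \<rho> K v + \<rho>)"
  using partition_fun_pos[OF _ assms(2), of K] partition_fun_pos[OF _ assms(2), of "K - {v}"] assms(1)
  by (simp add: vacancy_def msg_def)

text \<open>Dividing \<open>partition_fun_rec\<close> by \<open>Z(K - v)\<close> and doubling gives
  \<open>2 * \<rho>\<close> plus doubled vacancy ratios. One \<open>\<rho>\<close> cancels, and each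
  doubled ratio is \<open>4 / (msg + \<rho>)\<close>.\<close>

lemma msg_rec:
  assumes "finite K" "v \<in> K" "\<rho> > 0"
  shows "msg \<rho> K v = \<rho> + (\<Sum>w\<in>K \<inter> nbrs v. 4 / (msg \<rho> (K - {v}) w + \<rho>))"
proof -
  define Z where "Z = partition_fun (K - {v}) \<rho>"
  have Z: "Z > 0" unfolding Z_def using assms by (intro partition_fun_pos) auto
  have "4 / (msg \<rho> (K - {v}) w + \<rho>) = 2 * partition_fun (K - {v, w}) \<rho> / Z" for w
    using vacancy_singleton[of "K - {v}" \<rho> w] assms
    by (simp add: vacancy_def Z_def Diff_insert2[symmetric] insert_commute)
  then have "(\<Sum>w\<in>K \<inter> nbrs v. 4 / (msg \<rho> (K - {v}) w + \<rho>)) =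
      2 * (\<Sum>w\<in>K \<inter> nbrs v. partition_fun (K - {v, w}) \<rho>) / Z"
    by (simp add: sum_distrib_left sum_divide_distrib)
  moreover have "msg \<rho> K v =
      2 * (\<rho> * Z + (\<Sum>w\<in>K \<inter> nbrs v. partition_fun (K - {v, w}) \<rho>)) / Z - \<rho>"
    unfolding msg_def partition_fun_rec[OF assms(1,2)] Z_def ..
  ultimately show ?thesis
    using Z by (simp add: add_divide_distrib distrib_left)
qed

lemma msg_pos:
  assumes "finite K" "\<rho> > 0"
  shows "msg \<rho> K v + \<rho> > 0"
  using partition_fun_pos[OF _ assms(2), of K] partition_fun_pos[OF _ assms(2), of "K - {v}"] assms(1)
  by (simp add: msg_def)

lemma msg_ge:
  assumes "finite K" "v \<in> K" "\<rho> > 0"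
  shows "msg \<rho> K v \<ge> \<rho>"
  unfolding msg_rec[OF assms] using msg_pos[of "K - {v}" \<rho>] assms
  by (auto intro!: sum_nonneg simp: less_imp_le)

lemma card_Int_nbrs_le: "card (K \<inter> nbrs (v :: int ^ 'd)) \<le> 2 * CARD('d)"
  using card_nbrs_le[of v] card_mono[of "nbrs v" "K \<inter> nbrs v"] by simp

text \<open>Feeding the lower bound \<open>msg_ge\<close> back into the recursion bounds each of the
  at most 2d terms by \<open>2 / \<rho>\<close>.\<close>

lemma msg_le:
  fixes v :: "int ^ 'd"
  assumes "finite K" "v \<in> K" "\<rho> > 0"
  shows "msg \<rho> K v \<le> \<rho> * (1 + 4 * real CARD('d) / \<rho>\<^sup>2)"
proof -
  have "4 / (msg \<rho> (K - {v}) w + \<rho>) \<le> 2 / \<rho>" if "w \<in> K \<inter> nbrs v" for w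
  proof -
    have "w \<in> K - {v}" using that not_in_nbrs_self by auto
    then have "msg \<rho> (K - {v}) w \<ge> \<rho>"
      using assms by (intro msg_ge) auto
    then have "4 / (msg \<rho> (K - {v}) w + \<rho>) \<le> 4 / (\<rho> + \<rho>)"
      using assms by (intro divide_left_mono) auto
    then show ?thesis by simp
  qed
  then have "(\<Sum>w\<in>K \<inter> nbrs v. 4 / (msg \<rho> (K - {v}) w + \<rho>)) \<le> real (card (K \<inter> nbrs v)) * (2 / \<rho>)"
    by (rule sum_bounded_above)
  also have "\<dots> \<le> real (2 * CARD('d)) * (2 / \<rho>)"
    using card_Int_nbrs_le[of K v] assms by (intro mult_right_mono of_nat_mono) auto
  finally show ?thesis
    unfolding msg_rec[OF assms] using assms by (simp add: field_simps power2_eq_square)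
qed

text \<open>The largest \<open>e\<close> that \<open>recursion_contraction\<close> admits with
  \<open>N = 2d\<close>.\<close>

definition decay_rate :: "'d itself \<Rightarrow> real \<Rightarrow> real" where
  "decay_rate _ \<rho> = min (1 / 2) (\<rho> / (2 * real CARD('d)))"

text \<open>The recursion variable lies between \<open>\<rho>\<close> and \<open>\<rho> * exp (log_range _ \<rho>)\<close>.\<close>

definition log_range :: "'d itself \<Rightarrow> real \<Rightarrow> real" where
  "log_range _ \<rho> = ln (1 + 4 * real CARD('d) / \<rho>\<^sup>2)"

lemma decay_rate_bounds:
  assumes "\<rho> > 0"
  shows "decay_rate TYPE('d::finite) \<rho> > 0" "decay_rate TYPE('d) \<rho> \<le> 1 / 2"
  using assms by (auto simp: decay_rate_def)

lemma log_range_pos: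
  assumes "\<rho> > 0"
  shows "log_range TYPE('d::finite) \<rho> > 0"
  unfolding log_range_def using assms by (intro ln_gt_zero) simp

text \<open>Each application of the recursion moves to a neighbour, which costs one unit of the
  radius of agreement and gains one contraction factor on the logarithm. At radius 0 only the a
  priori range of \<open>msg\<close> is used.\<close>

lemma msg_mixing:
  fixes v :: "int ^ 'd"
  assumes "\<rho> > 0" "finite K" "finite K'" "v \<in> K" "v \<in> K'"
    and "\<And>x. lattice_dist v x \<le> l \<Longrightarrow> x \<in> K \<longleftrightarrow> x \<in> K'"
  shows "msg \<rho> K' v \<le> exp ((1 - decay_rate TYPE('d) \<rho>) ^ l * log_range TYPE('d) \<rho>) * msg \<rho> K v"
  using assms(2-)
proof (induction l arbitrary: K K' v)
  case 0
  have "msg \<rho> K' v \<le> (1 + 4 * real CARD('d) / \<rho>\<^sup>2) * \<rho>"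
    using msg_le[of K' v \<rho>] 0 assms(1) by (simp add: mult.commute)
  also have "\<dots> \<le> (1 + 4 * real CARD('d) / \<rho>\<^sup>2) * msg \<rho> K v"
    using 0 assms(1) by (intro mult_left_mono msg_ge) auto
  also have "1 + 4 * real CARD('d) / \<rho>\<^sup>2 = exp (log_range TYPE('d) \<rho>)"
    unfolding log_range_def using assms(1) by (subst exp_ln) (auto intro: add_pos_nonneg)
  finally show ?case by simp
next
  case (Suc l)
  define q where "q = 1 - decay_rate TYPE('d) \<rho>"
  define \<delta> where "\<delta> = q ^ l * log_range TYPE('d) \<rho>"
  have q: "q \<ge> 0" using decay_rate_bounds[OF assms(1), where 'd = 'd] by (simp add: q_def)
  have nb: "K' \<inter> nbrs v = K \<inter> nbrs v"
    using Suc.prems(5) lattice_dist_nbrs[of _ v] by auto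
  \<comment> \<open>The roles of \<open>K\<close> and \<open>K'\<close> are exchanged, since the
    recursion reverses order; the hypotheses are symmetric in them.\<close>
  have le: "msg \<rho> (K - {v}) w \<le> exp \<delta> * msg \<rho> (K' - {v}) w" if w: "w \<in> K \<inter> nbrs v" for w
    unfolding \<delta>_def q_def
  proof (rule Suc.IH)
    show "w \<in> K - {v}" "w \<in> K' - {v}" using w nb not_in_nbrs_self by blast+
    show "x \<in> K' - {v} \<longleftrightarrow> x \<in> K - {v}" if "lattice_dist w x \<le> l" for x
    proof -
      have "lattice_dist v x \<le> Suc l"
        using lattice_dist_triangle[of v x w] lattice_dist_nbrs[of w v] that w by simp
      then show ?thesis using Suc.prems(5) by blast
    qed
  qed (use Suc.prems in auto)
  have pos: "msg \<rho> (K - {v}) w > 0" "msg \<rho> (K' - {v}) w > 0" if w: "w \<in> K \<inter> nbrs v" for w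
  proof -
    have "w \<in> K - {v}" "w \<in> K' - {v}" using w nb not_in_nbrs_self by blast+
    then have "msg \<rho> (K - {v}) w \<ge> \<rho>" "msg \<rho> (K' - {v}) w \<ge> \<rho>"
      using Suc.prems assms(1) by (auto intro: msg_ge)
    then show "msg \<rho> (K - {v}) w > 0" "msg \<rho> (K' - {v}) w > 0" using assms(1) by linarith+
  qed
  have "msg \<rho> K' v = \<rho> + (\<Sum>w\<in>K \<inter> nbrs v. 4 / (msg \<rho> (K' - {v}) w + \<rho>))"
    using msg_rec[of K' v \<rho>] Suc.prems assms(1) nb by simp
  also have "\<dots> \<le> exp ((1 - decay_rate TYPE('d) \<rho>) * \<delta>) *
      (\<rho> + (\<Sum>w\<in>K \<inter> nbrs v. 4 / (msg \<rho> (K - {v}) w + \<rho>)))"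
  proof (rule recursion_contraction[OF card_Int_nbrs_le _ assms(1)])
    show "\<delta> \<ge> 0" unfolding \<delta>_def
      using q log_range_pos[OF assms(1), where 'd = 'd] by simp
    show "2 \<le> 2 * CARD('d)" by (simp add: Suc_leI)
  qed (use pos le in \<open>auto simp: decay_rate_def\<close>)
  also have "\<rho> + (\<Sum>w\<in>K \<inter> nbrs v. 4 / (msg \<rho> (K - {v}) w + \<rho>)) = msg \<rho> K v"
    using msg_rec[of K v \<rho>] Suc.prems assms(1) by simp
  finally show ?case by (simp add: \<delta>_def q_def mult.assoc)
qed

text \<open>Turns a bound on the ratio of two \<open>msg\<close> values into a bound on the
  difference of vacancy ratios. From \<open>1 - t \<le> exp (- t)\<close> follows
  \<open>b - a \<le> b * t\<close>, and the factor \<open>b\<close> is absorbed by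
  \<open>(a + \<rho>) * (b + \<rho>) \<ge> 2 * \<rho> * b\<close>.\<close>

lemma inverse_shift_diff_le:
  fixes a b t \<rho> :: real
  assumes "\<rho> > 0" "a \<ge> \<rho>" "b \<ge> \<rho>" "t \<ge> 0" "b \<le> exp t * a"
  shows "2 / (a + \<rho>) - 2 / (b + \<rho>) \<le> t / \<rho>"
proof -
  have "b * exp (- t) \<le> a" using assms(5) by (simp add: exp_minus field_simps)
  moreover have "b * (1 - t) \<le> b * exp (- t)"
    using exp_ge_add_one_self[of "- t"] assms by (intro mult_left_mono) auto
  ultimately have "b - a \<le> b * t" by (simp add: algebra_simps)
  then have "(b - a) * (2 * \<rho>) \<le> (b * t) * (2 * \<rho>)"
    using assms by (intro mult_right_mono) auto
  also have "\<dots> = t * ((2 * \<rho>) * b)" by simp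
  also have "\<dots> \<le> t * ((a + \<rho>) * (b + \<rho>))"
    using assms by (intro mult_left_mono mult_mono) auto
  finally have "(b - a) * (2 * \<rho>) \<le> t * ((a + \<rho>) * (b + \<rho>))" .
  moreover have "2 / (a + \<rho>) - 2 / (b + \<rho>) = 2 * (b - a) / ((a + \<rho>) * (b + \<rho>))"
    using assms by (simp add: field_simps)
  ultimately show ?thesis
    using assms by (simp add: divide_le_eq pos_le_divide_eq mult_ac)
qed

lemma vacancy_singleton_mixing:
  fixes v :: "int ^ 'd"
  assumes "\<rho> > 0" "finite K" "finite K'" "v \<in> K" "v \<in> K'"
    and agree: "\<And>x. lattice_dist v x \<le> l \<Longrightarrow> x \<in> K \<longleftrightarrow> x \<in> K'"
  shows "\<bar>vacancy \<rho> K {v} - vacancy \<rho> K' {v}\<bar> \<le>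
    (1 - decay_rate TYPE('d) \<rho>) ^ l * log_range TYPE('d) \<rho> / \<rho>" (is "_ \<le> ?t / \<rho>")
proof -
  have t: "?t \<ge> 0"
    using decay_rate_bounds[OF assms(1), where 'd = 'd] log_range_pos[OF assms(1), where 'd = 'd]
    by simp
  have ge: "msg \<rho> K v \<ge> \<rho>" "msg \<rho> K' v \<ge> \<rho>"
    using assms by (auto intro: msg_ge)
  have "msg \<rho> K' v \<le> exp ?t * msg \<rho> K v"
    using assms by (intro msg_mixing) auto
  moreover have "msg \<rho> K v \<le> exp ?t * msg \<rho> K' v"
    using assms by (intro msg_mixing) auto
  ultimately show ?thesis
    using inverse_shift_diff_le[OF assms(1) ge t]
      inverse_shift_diff_le[OF assms(1) ge(2,1) t] assms(1-3)
    by (simp add: vacancy_singleton abs_le_iff)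
qed

section \<open>Vacancy ratios of finite sets\<close>

lemma vacancy_insert:
  assumes "finite K" "\<rho> > 0"
  shows "vacancy \<rho> K (insert a A) = vacancy \<rho> K {a} * vacancy \<rho> (K - {a}) A"
proof -
  have "K - insert a A = K - {a} - A" by blast
  then show ?thesis
    using partition_fun_pos[of "K - {a}" \<rho>] assms by (simp add: vacancy_def)
qed

lemma vacancy_nonneg:
  assumes "finite K" "\<rho> > 0"
  shows "vacancy \<rho> K A \<ge> 0"
  using partition_fun_pos[of K \<rho>] partition_fun_pos[of "K - A" \<rho>] assms
  by (simp add: vacancy_def)

lemma vacancy_singleton_le:
  assumes "finite K" "v \<in> K" "\<rho> > 0"
  shows "vacancy \<rho> K {v} \<le> 1 / \<rho>"
proof -
  have "2 / (msg \<rho> K v + \<rho>) \<le> 2 / (\<rho> + \<rho>)"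
    using msg_ge[OF assms] assms by (intro divide_left_mono) auto
  then show ?thesis using assms by (simp add: vacancy_singleton)
qed

lemma vacancy_le:
  assumes "finite K" "A \<subseteq> K" "\<rho> > 0"
  shows "vacancy \<rho> K A \<le> (1 / \<rho>) ^ card A"
proof -
  have "finite A" using assms finite_subset by blast
  then show ?thesis using assms(1,2)
  proof (induction A arbitrary: K)
    case empty
    then show ?case using partition_fun_pos[of K \<rho>] assms by (simp add: vacancy_def)
  next
    case (insert a A)
    have "vacancy \<rho> K (insert a A) = vacancy \<rho> K {a} * vacancy \<rho> (K - {a}) A"
      by (rule vacancy_insert[OF insert.prems(1) assms(3)])
    also have "\<dots> \<le> (1 / \<rho>) * (1 / \<rho>) ^ card A"
      using insert.prems insert.hyps assms(3)
      by (intro mult_mono vacancy_singleton_le insert.IH vacancy_nonneg) auto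
    finally show ?case using insert.hyps by simp
  qed
qed

text \<open>Vertices of \<open>A\<close> are removed one at a time, in both volumes alike, so the
  remaining volumes still agree near \<open>A\<close>. Each of the \<open>card A\<close> factors
  contributes one error \<open>T / \<rho>\<close>, while the other factors are at most
  \<open>1 / \<rho>\<close>.\<close>

lemma vacancy_mixing:
  fixes A :: "(int ^ 'd) set"
  assumes \<rho>: "\<rho> > 0" and "finite K" "finite K'" "A \<subseteq> K" "A \<subseteq> K'"
    and "\<And>a x. a \<in> A \<Longrightarrow> lattice_dist a x \<le> l \<Longrightarrow> x \<in> K \<longleftrightarrow> x \<in> K'"
  shows "\<bar>vacancy \<rho> K A - vacancy \<rho> K' A\<bar> \<le> real (card A) * (1 / \<rho>) ^ card A *
    ((1 - decay_rate TYPE('d) \<rho>) ^ l * log_range TYPE('d) \<rho>)"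
proof -
  define T where "T = (1 - decay_rate TYPE('d) \<rho>) ^ l * log_range TYPE('d) \<rho>"
  have "finite A" using assms finite_subset by blast
  then have "\<bar>vacancy \<rho> K A - vacancy \<rho> K' A\<bar> \<le> real (card A) * (1 / \<rho>) ^ card A * T"
    using assms(2-)
  proof (induction A arbitrary: K K')
    case empty
    then show ?case
      using partition_fun_pos[of K \<rho>] partition_fun_pos[of K' \<rho>] \<rho> by (simp add: vacancy_def)
  next
    case (insert a A)
    let ?x = "vacancy \<rho> K {a}" and ?x' = "vacancy \<rho> K' {a}"
    let ?y = "vacancy \<rho> (K - {a}) A" and ?y' = "vacancy \<rho> (K' - {a}) A"
    have x: "\<bar>?x - ?x'\<bar> \<le> T / \<rho>"
      unfolding T_def using insert.prems \<rho> by (intro vacancy_singleton_mixing) auto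
    have y: "\<bar>?y - ?y'\<bar> \<le> real (card A) * (1 / \<rho>) ^ card A * T"
      using insert.prems insert.hyps by (intro insert.IH) auto
    have "vacancy \<rho> K (insert a A) - vacancy \<rho> K' (insert a A) = ?x * ?y - ?x' * ?y'"
      by (intro arg_cong2[where f = minus] vacancy_insert insert.prems \<rho>)
    also have "\<dots> = (?x - ?x') * ?y + ?x' * (?y - ?y')"
      by (simp add: algebra_simps)
    also have "\<bar>\<dots>\<bar> \<le> \<bar>?x - ?x'\<bar> * \<bar>?y\<bar> + \<bar>?x'\<bar> * \<bar>?y - ?y'\<bar>"
      unfolding abs_mult[symmetric] by (rule abs_triangle_ineq)
    also have "\<dots> \<le> T / \<rho> * (1 / \<rho>) ^ card A + 1 / \<rho> * (real (card A) * (1 / \<rho>) ^ card A * T)"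
    proof (intro add_mono mult_mono x y)
      have "A \<subseteq> K - {a}" "a \<in> K'" using insert.prems insert.hyps by auto
      then show "\<bar>?y\<bar> \<le> (1 / \<rho>) ^ card A" "\<bar>?x'\<bar> \<le> 1 / \<rho>"
        using insert.prems \<rho> vacancy_nonneg[of "K - {a}" \<rho> A] vacancy_nonneg[of K' \<rho> "{a}"]
          vacancy_le[of "K - {a}" A \<rho>] vacancy_singleton_le[of K' a \<rho>]
        by simp_all
      show "0 \<le> T / \<rho>" using x abs_ge_zero order_trans by blast
    qed (use \<rho> in simp_all)
    also have "\<dots> = (1 + real (card A)) * (1 / \<rho> * (1 / \<rho>) ^ card A) * T"
      by (simp add: divide_inverse algebra_simps)
    also have "\<dots> = real (card (insert a A)) * (1 / \<rho>) ^ card (insert a A) * T"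
      using insert.hyps by (simp del: power_one_over)
    finally show ?case .
  qed
  then show ?thesis by (simp add: T_def)
qed

section \<open>Covariances in finite volume\<close>

lemma U_finite_eq_vacancy:
  "U_finite K \<rho> A B = vacancy \<rho> K (A \<union> B) - vacancy \<rho> K A * vacancy \<rho> K B"
  by (simp add: U_finite_def vacancy_def)

lemma vacancy_Un:
  assumes "finite K" "\<rho> > 0"
  shows "vacancy \<rho> K (A \<union> B) = vacancy \<rho> K B * vacancy \<rho> (K - B) A"
proof -
  have "K - (A \<union> B) = K - B - A" by blast
  then show ?thesis
    using partition_fun_pos[of "K - B" \<rho>] assms by (simp add: vacancy_def)
qed

lemma U_finite_decay:
  fixes A B :: "(int ^ 'd) set"
  assumes "\<rho> > 0" "finite K" "A \<union> B \<subseteq> K" "A \<inter> B = {}"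
    and "\<And>a b. a \<in> A \<Longrightarrow> b \<in> B \<Longrightarrow> lattice_dist a b > l"
  shows "\<bar>U_finite K \<rho> A B\<bar> \<le> real (card A) * (1 / \<rho>) ^ (card A + card B) *
    ((1 - decay_rate TYPE('d) \<rho>) ^ l * log_range TYPE('d) \<rho>)" (is "_ \<le> _ * ?T")
proof -
  have "U_finite K \<rho> A B = vacancy \<rho> K B * (vacancy \<rho> (K - B) A - vacancy \<rho> K A)"
    unfolding U_finite_eq_vacancy vacancy_Un[OF assms(2,1)] by (simp add: algebra_simps)
  then have "\<bar>U_finite K \<rho> A B\<bar> = vacancy \<rho> K B * \<bar>vacancy \<rho> (K - B) A - vacancy \<rho> K A\<bar>"
    using vacancy_nonneg[OF assms(2,1), of B] by (simp add: abs_mult)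
  also have "\<dots> \<le> (1 / \<rho>) ^ card B * (real (card A) * (1 / \<rho>) ^ card A * ?T)"
  proof (intro mult_mono vacancy_le vacancy_mixing)
    \<comment> \<open>All of \<open>B\<close> is farther than \<open>l\<close> from
      \<open>A\<close>, so its deletion is invisible within that radius.\<close>
    show "x \<in> K - B \<longleftrightarrow> x \<in> K" if "a \<in> A" "lattice_dist a x \<le> l" for a x
      using assms(5)[of a x] that by fastforce
  qed (use assms in auto)
  finally show ?thesis by (simp add: power_add mult_ac)
qed

section \<open>The infinite-volume limit\<close>

text \<open>By \<open>vacancy_mixing\<close>, any two finite volumes containing the
  \<open>l\<close>-neighbourhood of \<open>A\<close> give nearly equal values. The limit is first
  found along the cubes, by completeness, and then carried over to all finite sets.\<close>

lemma vacancy_convergent: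
  fixes A :: "(int ^ 'd) set"
  assumes \<rho>: "\<rho> > 0" and A: "finite A"
  shows "\<exists>L. ((\<lambda>K. vacancy \<rho> K A) \<longlongrightarrow> L) (finite_subsets_at_top UNIV)"
proof -
  define q where "q = 1 - decay_rate TYPE('d) \<rho>"
  have q: "0 \<le> q" "q < 1"
    using decay_rate_bounds[OF \<rho>, where 'd = 'd] by (auto simp: q_def)
  define C where "C = real (card A) * (1 / \<rho>) ^ card A * log_range TYPE('d) \<rho>"
  have cauchy: "\<exists>F. finite F \<and> (\<forall>K K'. finite K \<longrightarrow> finite K' \<longrightarrow> F \<subseteq> K \<longrightarrow> F \<subseteq> K' \<longrightarrow>
      \<bar>vacancy \<rho> K A - vacancy \<rho> K' A\<bar> < \<eta>)" if \<eta>: "\<eta> > 0" for \<eta>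
  proof -
    have "(\<lambda>l. C * q ^ l) \<longlonglongrightarrow> C * 0"
      using q by (intro tendsto_intros LIMSEQ_power_zero) auto
    then have "\<forall>\<^sub>F l in sequentially. C * q ^ l < \<eta>"
      using \<eta> by (intro order_tendstoD) auto
    then obtain l where l: "C * q ^ l < \<eta>"
      using eventually_happens by fastforce
    define F where "F = (\<Union>a\<in>A. {x. lattice_dist a x \<le> l})"
    have "\<bar>vacancy \<rho> K A - vacancy \<rho> K' A\<bar> < \<eta>"
      if "finite K" "finite K'" "F \<subseteq> K" "F \<subseteq> K'" for K K'
    proof -
      have "a \<in> F" if "a \<in> A" for a
        unfolding F_def by (rule UN_I[OF that]) simp
      then have "\<bar>vacancy \<rho> K A - vacancy \<rho> K' A\<bar> \<le> real (card A) * (1 / \<rho>) ^ card A *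
          (q ^ l * log_range TYPE('d) \<rho>)"
        unfolding q_def using that \<rho> by (intro vacancy_mixing) (auto simp: F_def)
      also have "\<dots> = C * q ^ l" by (simp add: C_def)
      finally show ?thesis using l by linarith
    qed
    moreover have "finite F"
      unfolding F_def by (intro finite_UN_I A finite_lattice_ball)
    ultimately show ?thesis by blast
  qed
  let ?f = "\<lambda>k. vacancy \<rho> (box_seq k) A"
  have ev: "\<exists>k\<^sub>0. \<forall>k\<ge>k\<^sub>0. F \<subseteq> box_seq k" if "finite F" for F :: "(int ^ 'd) set"
  proof -
    have "\<forall>\<^sub>F k in sequentially. F \<subseteq> box_seq k"
      using van_hove_imp_filterlim[OF van_hove_box_seq, unfolded filterlim_finite_subsets_at_top,
          rule_format, of F] that by (auto elim: eventually_mono)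
    then show ?thesis unfolding eventually_sequentially by meson
  qed
  have "Cauchy ?f"
  proof (rule metric_CauchyI)
    fix \<eta> :: real assume "\<eta> > 0"
    from cauchy[OF this] obtain F where F: "finite F" "\<forall>K K'. finite K \<longrightarrow> finite K' \<longrightarrow>
        F \<subseteq> K \<longrightarrow> F \<subseteq> K' \<longrightarrow> \<bar>vacancy \<rho> K A - vacancy \<rho> K' A\<bar> < \<eta>"
      by (elim exE conjE)
    obtain k\<^sub>0 where k\<^sub>0: "\<And>k. k \<ge> k\<^sub>0 \<Longrightarrow> F \<subseteq> box_seq k" using ev[OF F(1)] by blast
    have "dist (?f m) (?f n) < \<eta>" if "m \<ge> k\<^sub>0" "n \<ge> k\<^sub>0" for m n
      unfolding dist_real_def by (rule F(2)[rule_format, OF finite_box_seq finite_box_seq k\<^sub>0[OF that(1)] k\<^sub>0[OF that(2)]])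
    then show "\<exists>M. \<forall>m\<ge>M. \<forall>n\<ge>M. dist (?f m) (?f n) < \<eta>" by blast
  qed
  then obtain L where L: "?f \<longlonglongrightarrow> L"
    using Cauchy_convergent convergent_def by blast
  have "((\<lambda>K. vacancy \<rho> K A) \<longlongrightarrow> L) (finite_subsets_at_top UNIV)"
  proof (rule tendstoI)
    fix \<eta> :: real assume \<eta>: "\<eta> > 0"
    \<comment> \<open>Passing to the limit keeps only a weak inequality; half of
      \<open>\<eta>\<close> leaves room for the strict one.\<close>
    then have "\<eta> / 2 > 0" by simp
    from cauchy[OF this] obtain F where F: "finite F" "\<forall>K K'. finite K \<longrightarrow> finite K' \<longrightarrow>
        F \<subseteq> K \<longrightarrow> F \<subseteq> K' \<longrightarrow> \<bar>vacancy \<rho> K A - vacancy \<rho> K' A\<bar> < \<eta> / 2"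
      by (elim exE conjE)
    obtain k\<^sub>0 where k\<^sub>0: "\<And>k. k \<ge> k\<^sub>0 \<Longrightarrow> F \<subseteq> box_seq k" using ev[OF F(1)] by blast
    have "dist (vacancy \<rho> K A) L < \<eta>" if K: "finite K" "F \<subseteq> K" for K
    proof -
      have "(\<lambda>k. \<bar>vacancy \<rho> K A - ?f k\<bar>) \<longlonglongrightarrow> \<bar>vacancy \<rho> K A - L\<bar>"
        by (intro tendsto_intros L)
      moreover have "\<bar>vacancy \<rho> K A - ?f k\<bar> \<le> \<eta> / 2" if "k \<ge> k\<^sub>0" for k
        using F(2)[rule_format, OF K(1) finite_box_seq K(2) k\<^sub>0[OF that]] by simp
      ultimately have "\<bar>vacancy \<rho> K A - L\<bar> \<le> \<eta> / 2"
        using LIMSEQ_le_const2 by blast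
      then show ?thesis using \<eta> by (simp add: dist_real_def)
    qed
    then show "\<forall>\<^sub>F K in finite_subsets_at_top UNIV. dist (vacancy \<rho> K A) L < \<eta>"
      unfolding eventually_finite_subsets_at_top using F(1) by blast
  qed
  then show ?thesis by blast
qed

text \<open>Shows that the definite description in \<open>U_inf\<close> is well defined and
  identifies it with the limit over all finite sets.\<close>

lemma U_finite_tendsto_U_inf:
  fixes A B :: "(int ^ 'd) set"
  assumes "\<rho> > 0" "finite A" "finite B"
  shows "((\<lambda>K. U_finite K \<rho> A B) \<longlongrightarrow> U_inf \<rho> A B) (finite_subsets_at_top UNIV)"
proof -
  obtain a b c where
      "((\<lambda>K. vacancy \<rho> K A) \<longlongrightarrow> a) (finite_subsets_at_top UNIV)"
      "((\<lambda>K. vacancy \<rho> K B) \<longlongrightarrow> b) (finite_subsets_at_top UNIV)"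
      "((\<lambda>K. vacancy \<rho> K (A \<union> B)) \<longlongrightarrow> c) (finite_subsets_at_top UNIV)"
    using vacancy_convergent[OF assms(1)] assms(2,3) finite_UnI by metis
  then have u: "((\<lambda>K. U_finite K \<rho> A B) \<longlongrightarrow> c - a * b) (finite_subsets_at_top UNIV)"
    unfolding U_finite_eq_vacancy by (intro tendsto_intros)
  have "U_inf \<rho> A B = c - a * b"
    unfolding U_inf_def
  proof (rule the_equality)
    show "\<forall>K. van_hove K \<longrightarrow> (\<lambda>k. U_finite (K k) \<rho> A B) \<longlonglongrightarrow> c - a * b"
      using filterlim_compose[OF u van_hove_imp_filterlim] by blast
    \<comment> \<open>Uniqueness follows by testing on the cubes.\<close>
    show "u = c - a * b" if "\<forall>K. van_hove K \<longrightarrow> (\<lambda>k. U_finite (K k) \<rho> A B) \<longlonglongrightarrow> u" for u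
      using that van_hove_box_seq filterlim_compose[OF u van_hove_imp_filterlim] LIMSEQ_unique
      by blast
  qed
  with u show ?thesis by simp
qed

section \<open>Decay in infinite volume\<close>

lemma lattice_setdist_le:
  assumes "a \<in> A" "b \<in> B"
  shows "lattice_setdist A B \<le> lattice_dist a b"
  unfolding lattice_setdist_def using assms by (intro cInf_lower) auto

lemma lattice_setdist_pos:
  assumes "A \<noteq> {}" "B \<noteq> {}" "A \<inter> B = {}"
  shows "lattice_setdist A B > 0"
proof -
  have "lattice_setdist A B \<in> {lattice_dist u v | u v. u \<in> A \<and> v \<in> B}"
    unfolding lattice_setdist_def using assms(1,2) by (intro Inf_nat_def1) auto
  then obtain u v where "lattice_setdist A B = lattice_dist u v" "u \<in> A" "v \<in> B" by blast
  then show ?thesis using assms(3) lattice_dist_eq_0_iff[of u v] by auto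
qed

lemma U_inf_decay:
  fixes A B :: "(int ^ 'd) set"
  assumes \<rho>: "\<rho> > 0" and fin: "finite A" "finite B" and ne: "A \<noteq> {}" "B \<noteq> {}" and "A \<inter> B = {}"
  shows "\<bar>U_inf \<rho> A B\<bar> \<le> real (card A) * (1 / \<rho>) ^ (card A + card B) * log_range TYPE('d) \<rho> * exp 1 *
    exp (- decay_rate TYPE('d) \<rho> * real (lattice_setdist A B))"
proof -
  define e where "e = decay_rate TYPE('d) \<rho>"
  define C where "C = real (card A) * (1 / \<rho>) ^ (card A + card B) * log_range TYPE('d) \<rho>"
  \<comment> \<open>\<open>U_finite_decay\<close> needs distances strictly above \<open>l\<close>,
    so \<open>l\<close> is one less than the distance. The lost factor \<open>exp e\<close> is
    bounded by \<open>exp 1\<close> at the end.\<close>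
  obtain l where l: "lattice_setdist A B = Suc l"
    using lattice_setdist_pos[OF ne \<open>A \<inter> B = {}\<close>] gr0_conv_Suc by blast
  have e: "0 < e" "e \<le> 1 / 2" unfolding e_def using decay_rate_bounds[OF \<rho>] by auto
  have C: "C \<ge> 0"
    unfolding C_def using \<rho> log_range_pos[OF \<rho>, where 'd = 'd] by simp
  have "\<bar>U_finite K \<rho> A B\<bar> \<le> C * (1 - e) ^ l" if "finite K" "A \<union> B \<subseteq> K" for K
  proof -
    have "lattice_dist a b > l" if "a \<in> A" "b \<in> B" for a b
      using lattice_setdist_le[OF that] l by simp
    then have "\<bar>U_finite K \<rho> A B\<bar> \<le> real (card A) * (1 / \<rho>) ^ (card A + card B) *
        ((1 - decay_rate TYPE('d) \<rho>) ^ l * log_range TYPE('d) \<rho>)"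
      using that assms by (intro U_finite_decay) auto
    then show ?thesis by (simp add: C_def e_def mult_ac)
  qed
  then have "\<forall>\<^sub>F K in finite_subsets_at_top UNIV. \<bar>U_finite K \<rho> A B\<bar> \<le> C * (1 - e) ^ l"
    unfolding eventually_finite_subsets_at_top using fin by (intro exI[of _ "A \<union> B"]) auto
  then have "\<bar>U_inf \<rho> A B\<bar> \<le> C * (1 - e) ^ l"
    using tendsto_rabs[OF U_finite_tendsto_U_inf[OF \<rho> fin]]
    by (intro tendsto_upperbound[of "\<lambda>K. \<bar>U_finite K \<rho> A B\<bar>"]) auto
  also have "\<dots> \<le> C * exp (- e) ^ l"
    using C e exp_ge_add_one_self[of "- e"] by (intro mult_left_mono power_mono) auto
  also have "exp (- e) ^ l = exp e * exp (- e * real (lattice_setdist A B))"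
    unfolding l exp_of_nat_mult[symmetric] exp_add[symmetric] by (simp add: algebra_simps)
  also have "C * \<dots> \<le> C * (exp 1 * exp (- e * real (lattice_setdist A B)))"
    using C e by (intro mult_left_mono mult_right_mono) auto
  finally show ?thesis by (simp add: C_def e_def mult_ac)
qed

theorem theorem2p1:
  fixes n m :: nat
  assumes "n \<ge> 1" and "m \<ge> 1"
  shows "\<exists>c c' :: real \<Rightarrow> real.
    (\<forall>\<rho>>0. c \<rho> > 0 \<and> c' \<rho> > 0) \<and>
    (\<forall>\<rho>>0. \<forall>A B :: (int ^ 'd) set.
       finite A \<and> finite B \<and> card A = n \<and> card B = m \<and> A \<inter> B = {} \<longrightarrow>
       \<bar>U_inf \<rho> A B\<bar> \<le> c' \<rho> * exp (- c \<rho> * real (lattice_setdist A B))) \<and>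
    (\<exists>c\<^sub>0>0. \<exists>\<rho>\<^sub>0>0. \<forall>\<rho>. 0 < \<rho> \<and> \<rho> \<le> \<rho>\<^sub>0 \<longrightarrow> c \<rho> = c\<^sub>0 * \<rho>)"
proof (intro exI conjI allI impI)
  let ?c = "decay_rate TYPE('d)"
  let ?c' = "\<lambda>\<rho>. real n * (1 / \<rho>) ^ (n + m) * log_range TYPE('d) \<rho> * exp 1"
  fix \<rho> :: real assume \<rho>: "\<rho> > 0"
  show "?c \<rho> > 0" by (rule decay_rate_bounds[OF \<rho>])
  show "?c' \<rho> > 0" using \<rho> assms(1) log_range_pos[OF \<rho>, where 'd = 'd] by simp
  fix A B :: "(int ^ 'd) set"
  assume AB: "finite A \<and> finite B \<and> card A = n \<and> card B = m \<and> A \<inter> B = {}"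
  then have "A \<noteq> {}" "B \<noteq> {}" using assms by auto
  then show "\<bar>U_inf \<rho> A B\<bar> \<le> ?c' \<rho> * exp (- ?c \<rho> * real (lattice_setdist A B))"
    using U_inf_decay[of \<rho> A B] AB \<rho> by simp
next
  \<comment> \<open>The minimum in \<open>decay_rate\<close> is attained by its linear term exactly
    when \<open>\<rho> \<le> d\<close>, which gives both witnesses.\<close>
  show "(1 / (2 * real CARD('d))) > 0" and "real CARD('d) > 0" by simp_all
  fix \<rho> :: real assume "0 < \<rho> \<and> \<rho> \<le> real CARD('d)"
  then show "decay_rate TYPE('d) \<rho> = 1 / (2 * real CARD('d)) * \<rho>"
    by (simp add: decay_rate_def min_def field_simps)
qed

end
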